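(* Let $q$ be a prime power and $m,n$ positive integers. An $(n,k)$ linear code over $\mathrm{GF}(q^m)$ with rank covering radius $\rho$ satisfies $$n-\rho-\frac{\rho(n-\rho)-\log_q K_q}{m}<k\le n-\rho,$$ where $K_q=\prod_{j=1}^\infty(1-q^{-j})$.
   Context: For $\mathbf{x}\in \mathrm{GF}(q^m)^n$, $\mathrm{rk}(\mathbf{x})$ is the maximum number of coordinates of $\mathbf{x}$ that are linearly independent over $\mathrm{GF}(q)$; the rank distance is $d_R(\mathbf{x},\mathbf{y})=\mathrm{rk}(\mathbf{x}-\mathbf{y})$. The rank covering radius of a code $C\subseteq \mathrm{GF}(q^m)^n$ is $\max_{\mathbf{x}\in\mathrm{GF}(q^m)^n}\min_{\mathbf{c}\in C} d_R(\mathbf{x},\mathbf{c})$. An $(n,k)$ linear code over $\mathrm{GF}(q^m)$ is a $k$-dimensional $\mathrm{GF}(q^m)$-subspace of $\mathrm{GF}(q^m)^n$. *)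

theory Defs
  imports
    "HOL-Analysis.Analysis"
    "HOL-Number_Theory.Prime_Powers"
begin

text \<open>
  The fields \<open>GF(q)\<close> and \<open>GF(q^m)\<close> are finite field types \<open>'f\<close> and \<open>'a\<close> with \<open>q\<close> and \<open>q^m\<close>
  elements. The inclusion of \<open>GF(q)\<close> in \<open>GF(q^m)\<close> is a ring homomorphism \<open>h\<close>; it is
  automatically injective since \<open>'f\<close> is a field and \<open>h 1 = 1\<close>.
\<close>

definition field_embedding :: "('f::field \<Rightarrow> 'a::field) \<Rightarrow> bool" where
  "field_embedding h \<longleftrightarrow>
     h 1 = 1 \<and> (\<forall>x y. h (x + y) = h x + h y) \<and> (\<forall>x y. h (x * y) = h x * h y)"

text \<open>
  The coordinates with index in \<open>I\<close> are linearly independent as a family: equal coordinates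
  at distinct indices count as dependent. The library notion is about sets of vectors,
  whence the injectivity condition.
\<close>

definition indep_coords ::
    "('f::field \<Rightarrow> 'a::field) \<Rightarrow> 'a ^ 'n \<Rightarrow> 'n set \<Rightarrow> bool" where
  "indep_coords h x I \<longleftrightarrow>
     inj_on (\<lambda>i. x $ i) I \<and>
     \<not> module.dependent (\<lambda>c v. h c * v) ((\<lambda>i. x $ i) ` I)"

definition rk :: "('f::field \<Rightarrow> 'a::field) \<Rightarrow> 'a ^ 'n \<Rightarrow> nat" where
  "rk h x = Max {card I | I. indep_coords h x I}"

definition rank_dist :: "('f::field \<Rightarrow> 'a::field) \<Rightarrow> 'a ^ 'n \<Rightarrow> 'a ^ 'n \<Rightarrow> nat" where
  "rank_dist h x y = rk h (x - y)"

definition rank_covering_radius ::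
    "('f::field \<Rightarrow> 'a::{field,finite}) \<Rightarrow> ('a ^ 'n) set \<Rightarrow> nat" where
  "rank_covering_radius h C = Max (range (\<lambda>x. Min (rank_dist h x ` C)))"

definition linear_code :: "nat \<Rightarrow> ('a::field ^ 'n) set \<Rightarrow> bool" where
  "linear_code k C \<longleftrightarrow> vec.subspace C \<and> vec.dim C = k"

text \<open>\<open>prodinf\<close> starts at \<open>0\<close>, so the factor for \<open>j \<ge> 1\<close> has index \<open>j - 1\<close>.\<close>

definition K_const :: "nat \<Rightarrow> real" where
  "K_const q = (\<Prod>i. 1 - 1 / real q ^ Suc i)"

end

theory Submission
  imports Defs
begin

text \<open>
  Upper bound: completing a basis of \<open>C\<close> by \<open>n - k\<close> unit vectors writes every \<open>x\<close> as a codeword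
  plus a vector supported on \<open>n - k\<close> coordinates, which has rank at most \<open>n - k\<close>.

  Lower bound: the balls of radius \<open>\<rho>\<close> around the codewords cover the space. A vector of rank at
  most \<open>\<rho>\<close> lies in the \<open>GF(q\<^sup>m)\<close>-span of a \<open>\<rho>\<close>-dimensional subspace of \<open>GF(q)\<^sup>n\<close>, hence in the
  \<open>GF(q\<^sup>m)\<close>-span of each of its \<open>q\<^bsup>\<rho>\<rho>\<^esup> \<Prod>\<^sub>i (1 - q\<^bsup>-i\<^esup>)\<close> ordered bases, \<open>1 \<le> i \<le> \<rho>\<close>. There are at
  most \<open>q\<^bsup>n\<rho>\<^esup>\<close> lists of \<open>\<rho>\<close> vectors, each spanning at most \<open>q\<^bsup>m\<rho>\<^esup>\<close> vectors, so a ball has fewer than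
  \<open>q\<^bsup>\<rho>(m + n - \<rho>)\<^esup> / K\<^sub>q\<close> elements.
\<close>

section \<open>Counting subspaces and independent lists over a finite field\<close>

lemma card_span_independent:
  fixes B :: "('a::{field,finite} ^ 'n) set"
  assumes "vec.independent B"
  shows "card (vec.span B) = CARD('a) ^ card B"
proof -
  let ?F = "\<lambda>u. \<Sum>v\<in>B. u v *s v"
  have "vec.span B = range ?F"
    by (rule vec.span_finite) simp
  \<comment> \<open>Only coefficients on \<open>B\<close> matter; fixing the others makes the
    representation unique.\<close>
  also have "\<dots> = ?F ` (B \<rightarrow>\<^sub>E UNIV)"
  proof -
    have "?F u \<in> ?F ` (B \<rightarrow>\<^sub>E UNIV)" for u
    proof (rule image_eqI)
      show "?F u = ?F (restrict u B)" by (intro sum.cong) auto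
    qed auto
    then show ?thesis by blast
  qed
  finally have "card (vec.span B) = card (?F ` (B \<rightarrow>\<^sub>E UNIV))" by simp
  also have "\<dots> = card (B \<rightarrow>\<^sub>E (UNIV :: 'a set))"
  proof (rule card_image, rule inj_onI)
    fix u w assume u: "u \<in> B \<rightarrow>\<^sub>E (UNIV :: 'a set)" and w: "w \<in> B \<rightarrow>\<^sub>E (UNIV :: 'a set)"
      and eq: "?F u = ?F w"
    have "(\<Sum>v\<in>B. (u v - w v) *s v) = 0"
      using eq by (simp add: vec.scale_left_diff_distrib sum_subtractf)
    then have "u v - w v = 0" if "v \<in> B" for v
      by (rule vec.independentD[where u = "\<lambda>v. u v - w v", OF assms finite order_refl _ that])
    then show "u = w"
      using u w by (intro PiE_ext[of u B _ w]) auto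
  qed
  also have "\<dots> = CARD('a) ^ card B"
    by (simp add: card_PiE)
  finally show ?thesis .
qed

lemma card_subspace:
  fixes W :: "('a::{field,finite} ^ 'n) set"
  assumes "vec.subspace W"
  shows "card W = CARD('a) ^ vec.dim W"
proof -
  obtain B where B: "B \<subseteq> W" "vec.independent B" "W \<subseteq> vec.span B" "card B = vec.dim W"
    using vec.basis_exists by blast
  then have "W = vec.span B"
    using assms vec.span_minimal by blast
  then show ?thesis
    using card_span_independent[OF B(2)] B(4) by simp
qed

lemma card_span_le:
  fixes B :: "('a::{field,finite} ^ 'n) set"
  shows "card (vec.span B) \<le> CARD('a) ^ card B"
proof -
  have "card (vec.span B) = CARD('a) ^ vec.dim (vec.span B)"
    by (rule card_subspace) (rule vec.subspace_span)
  also have "\<dots> \<le> CARD('a) ^ card B"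
    by (rule power_increasing) (auto simp: vec.dim_le_card vec.span_superset Suc_leI)
  finally show ?thesis .
qed

text \<open>If \<open>r\<close> is the dimension of the subspace \<open>W\<close>, these are its
  ordered bases.\<close>

definition indep_lists :: "('a::field ^ 'n) set \<Rightarrow> nat \<Rightarrow> ('a ^ 'n) list set" where
  "indep_lists W r =
     {us. length us = r \<and> distinct us \<and> set us \<subseteq> W \<and> vec.independent (set us)}"

lemma finite_indep_lists: "finite (indep_lists (W :: ('a::{field,finite} ^ 'n) set) r)"
  by (rule finite_subset[OF _ finite_lists_length_eq[of UNIV r]]) (auto simp: indep_lists_def)

text \<open>An independent list of length \<open>r\<close> can be extended by every vector of
  \<open>W\<close> outside its span, which has at most \<open>CARD('a) ^ r\<close> elements. For
  \<open>r > vec.dim W\<close> the factor at \<open>j = vec.dim W\<close> is 0, so the bound is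
  trivial there.\<close>

lemma card_indep_lists_ge:
  fixes W :: "('a::{field,finite} ^ 'n) set"
  assumes "vec.subspace W"
  shows "(\<Prod>j<r. CARD('a) ^ vec.dim W - CARD('a) ^ j) \<le> card (indep_lists W r)"
proof (induction r)
  case 0
  have "indep_lists W 0 = {[]}"
    by (auto simp: indep_lists_def vec.independent_empty)
  then show ?case by simp
next
  case (Suc r)
  let ?q = "CARD('a)" and ?d = "vec.dim W"
  let ?S = "SIGMA us:indep_lists W r. W - vec.span (set us)"
  have "(\<lambda>(us, u). u # us) ` ?S \<subseteq> indep_lists W (Suc r)"
  proof clarify
    fix us u assume us: "us \<in> indep_lists W r" and u: "u \<in> W" "u \<notin> vec.span (set us)"
    then have "u \<notin> set us" "vec.independent (insert u (set us))"
      by (auto simp: indep_lists_def vec.span_base dest: vec.independent_insertI)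
    then show "u # us \<in> indep_lists W (Suc r)"
      using us u(1) by (simp add: indep_lists_def)
  qed
  then have "card ((\<lambda>(us, u). u # us) ` ?S) \<le> card (indep_lists W (Suc r))"
    by (intro card_mono finite_indep_lists)
  moreover have "card ((\<lambda>(us, u). u # us) ` ?S) = card ?S"
    by (rule card_image) (auto simp: inj_on_def)
  moreover have "card ?S = (\<Sum>us\<in>indep_lists W r. card (W - vec.span (set us)))"
    by (simp add: finite_indep_lists)
  moreover have "card (indep_lists W r) * (?q ^ ?d - ?q ^ r) \<le>
      (\<Sum>us\<in>indep_lists W r. card (W - vec.span (set us)))"
  proof (subst of_nat_id[symmetric, of "card (indep_lists W r)"], rule sum_bounded_below)
    fix us assume us: "us \<in> indep_lists W r"
    then have "card (set us) = r"
      by (auto simp: indep_lists_def distinct_card)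
    then have "card (vec.span (set us)) \<le> ?q ^ r"
      using card_span_le[of "set us"] by simp
    then show "?q ^ ?d - ?q ^ r \<le> card (W - vec.span (set us))"
      using diff_card_le_card_Diff[of "vec.span (set us)" W] card_subspace[OF assms] by simp
  qed
  moreover have "(\<Prod>j<Suc r. ?q ^ ?d - ?q ^ j) \<le> card (indep_lists W r) * (?q ^ ?d - ?q ^ r)"
    using Suc.IH by (simp add: mult_le_mono)
  ultimately show ?case by linarith
qed

section \<open>Rank, extension of scalars and the size of rank balls\<close>

definition map_coords :: "('f \<Rightarrow> 'a) \<Rightarrow> 'f ^ 'n \<Rightarrow> 'a ^ 'n" where
  "map_coords h u = (\<chi> i. h (u $ i))"

lemma field_embedding_vector_space:
  assumes "field_embedding h"
  shows "vector_space (\<lambda>c v. h c * v)"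
  using assms by unfold_locales (auto simp: field_embedding_def algebra_simps)

lemma field_embedding_zero: "field_embedding h \<Longrightarrow> h 0 = 0"
  unfolding field_embedding_def by (metis add_cancel_right_right)

lemma rk_obtain:
  assumes "field_embedding h"
  obtains I where "indep_coords h x I" "card I = rk h x"
proof -
  interpret H: vector_space "\<lambda>c v. h c * v"
    using assms by (rule field_embedding_vector_space)
  let ?S = "{card I | I. indep_coords h x I}"
  have "finite ?S" by simp
  moreover have "indep_coords h x {}"
    by (simp add: indep_coords_def H.independent_empty)
  then have "?S \<noteq> {}" by blast
  ultimately have "rk h x \<in> ?S"
    unfolding rk_def by (rule Max_in)
  then show thesis using that by auto
qed

lemma card_le_rk:
  assumes "indep_coords h x I"
  shows "card I \<le> rk h x"
  unfolding rk_def using assms by (intro Max_ge) auto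

text \<open>A coordinate outside the span could be added to \<open>I\<close>, against the maximality
  of \<open>card I\<close>.\<close>

lemma coords_in_span:
  assumes h: "field_embedding h" and I: "indep_coords h x I" "card I = rk h x"
  shows "x $ i \<in> module.span (\<lambda>c v. h c * v) ((\<lambda>i. x $ i) ` I)"
proof (rule ccontr)
  interpret H: vector_space "\<lambda>c v. h c * v"
    using h by (rule field_embedding_vector_space)
  assume ni: "x $ i \<notin> H.span ((\<lambda>i. x $ i) ` I)"
  then have nx: "x $ i \<notin> (\<lambda>i. x $ i) ` I"
    using H.span_base by blast
  then have "i \<notin> I" by blast
  have "indep_coords h x (insert i I)"
    using I(1) ni nx H.independent_insertI[OF ni] by (auto simp: indep_coords_def)
  then show False
    using card_le_rk[of h x "insert i I"] \<open>i \<notin> I\<close> I(2) by simp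
qed

text \<open>Expanding every coordinate of \<open>x\<close> in a maximal independent family of
  coordinates gives a matrix \<open>a\<close> over the small field. Its embedded columns, weighted
  by the coordinates in that family, sum to \<open>x\<close>.\<close>

lemma rk_span_witness:
  fixes h :: "'f::field \<Rightarrow> 'a::field" and x :: "'a ^ 'n"
  assumes h: "field_embedding h"
  obtains B :: "('f ^ 'n) set"
  where "finite B" "card B \<le> rk h x" "x \<in> vec.span (map_coords h ` B)"
proof -
  interpret H: vector_space "\<lambda>c v. h c * v"
    using h by (rule field_embedding_vector_space)
  obtain I where I: "indep_coords h x I" "card I = rk h x"
    using h by (rule rk_obtain)
  have "\<exists>a. x $ i = (\<Sum>j\<in>I. h (a j) * x $ j)" for i
  proof -
    have "x $ i \<in> range (\<lambda>u. \<Sum>v\<in>(\<lambda>i. x $ i) ` I. h (u v) * v)"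
      using coords_in_span[OF h I, of i] H.span_finite[of "(\<lambda>i. x $ i) ` I"] by simp
    then obtain u where "x $ i = (\<Sum>v\<in>(\<lambda>i. x $ i) ` I. h (u v) * v)"
      by auto
    also have "\<dots> = (\<Sum>j\<in>I. h (u (x $ j)) * x $ j)"
      using I(1) by (simp add: indep_coords_def sum.reindex)
    finally show ?thesis by (intro exI[of _ "\<lambda>j. u (x $ j)"])
  qed
  then obtain a where a: "\<And>i. x $ i = (\<Sum>j\<in>I. h (a i j) * x $ j)"
    by metis
  \<comment> \<open>\<open>u j\<close> is column \<open>j\<close> of the matrix
    \<open>a\<close>.\<close>
  define u :: "'n \<Rightarrow> 'f ^ 'n" where "u j = (\<chi> i. a i j)" for j
  have "x = (\<Sum>j\<in>I. x $ j *s map_coords h (u j))"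
  proof (subst vec_eq_iff, intro allI)
    fix i
    show "x $ i = (\<Sum>j\<in>I. x $ j *s map_coords h (u j)) $ i"
      by (subst a) (simp add: map_coords_def u_def mult.commute)
  qed
  also have "\<dots> \<in> vec.span (map_coords h ` u ` I)"
    by (intro vec.span_sum vec.span_scale vec.span_base) auto
  finally show thesis
    using that[of "u ` I"] I(2) card_image_le[of I u] by simp
qed

text \<open>\<open>map_coords h\<close> is semilinear along \<open>h\<close>, so it carries linear
  combinations to linear combinations.\<close>

lemma map_coords_span:
  fixes h :: "'f::field \<Rightarrow> 'a::field" and u :: "'f ^ 'n"
  assumes h: "field_embedding h" and u: "u \<in> vec.span B"
  shows "map_coords h u \<in> vec.span (map_coords h ` B)"
  using u
proof (induction rule: vec.span_induct_alt)
  case base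
  have "map_coords h (0 :: 'f ^ 'n) = 0"
    by (simp add: map_coords_def vec_eq_iff field_embedding_zero[OF h])
  then show ?case by (simp add: vec.span_zero)
next
  case (step c b y)
  have "map_coords h (c *s b + y) = h c *s map_coords h b + map_coords h y"
    using h by (simp add: map_coords_def vec_eq_iff field_embedding_def)
  then show ?case
    using step by (simp add: vec.span_add vec.span_scale vec.span_base)
qed

text \<open>The dimension is made exactly \<open>r\<close>, whatever the rank of \<open>x\<close>,
  so that one lower bound on the number of ordered bases serves the whole ball.\<close>

lemma rk_span_witness_subspace:
  fixes h :: "'f::field \<Rightarrow> 'a::field" and x :: "'a ^ 'n"
  assumes h: "field_embedding h" and "rk h x \<le> r" "r \<le> CARD('n)"
  obtains W :: "('f ^ 'n) set"
  where "vec.subspace W" "vec.dim W = r"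
    and "\<And>B. W \<subseteq> vec.span B \<Longrightarrow> x \<in> vec.span (map_coords h ` B)"
proof -
  obtain B0 :: "('f ^ 'n) set"
    where B0: "finite B0" "card B0 \<le> rk h x" "x \<in> vec.span (map_coords h ` B0)"
    using h by (rule rk_span_witness)
  \<comment> \<open>\<open>B1\<close> is thinned out of \<open>B0\<close> and completed to a basis
    \<open>B2\<close> of the whole space; an intermediate set \<open>B3\<close> of exactly
    \<open>r\<close> vectors then spans the subspace.\<close>
  obtain B1 where B1: "B1 \<subseteq> B0" "vec.independent B1" "B0 \<subseteq> vec.span B1"
    using vec.maximal_independent_subset by blast
  obtain B2 where B2: "B1 \<subseteq> B2" "vec.independent B2" "UNIV \<subseteq> vec.span B2"
    using vec.maximal_independent_subset_extend[of B1 UNIV] B1(2) by auto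
  have "card B1 \<le> r"
    using card_mono[OF B0(1) B1(1)] B0(2) assms(2) by linarith
  moreover have "card B2 = CARD('n)"
    using B2(2,3) vec.dim_eq_card[of B2 UNIV] card_cart_basis[where 'a = 'f and 'i = 'n]
    by (auto simp: vec.dim_UNIV top.extremum_unique)
  moreover have "finite B2"
    using B2(2) vec.finiteI_independent by blast
  ultimately obtain B3 where B3: "B1 \<subseteq> B3" "B3 \<subseteq> B2" "card B3 = r"
    using exists_subset_between[of B1 r B2] B2(1) assms(3) by auto
  show thesis
  proof (rule that)
    show "vec.subspace (vec.span B3)" by (rule vec.subspace_span)
    show "vec.dim (vec.span B3) = r"
      using B3 B2(2) vec.independent_mono vec.dim_span_eq_card_independent by metis
    fix B :: "('f ^ 'n) set" assume "vec.span B3 \<subseteq> vec.span B"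
    then have "B0 \<subseteq> vec.span B"
      using B1(3) vec.span_mono[OF B3(1)] by blast
    then have "map_coords h ` B0 \<subseteq> vec.span (map_coords h ` B)"
      using map_coords_span[OF h] by blast
    then show "x \<in> vec.span (map_coords h ` B)"
      using B0(3) vec.span_minimal[OF _ vec.subspace_span] by blast
  qed
qed

text \<open>The product on the left is the order of \<open>GL\<^sub>r(q)\<close>.\<close>
lemma card_rank_ball_le:
  fixes h :: "'f::{field,finite} \<Rightarrow> 'a::{field,finite}"
  assumes h: "field_embedding h" and r: "r \<le> CARD('n)"
  shows "card {x :: 'a ^ 'n. rk h x \<le> r} * (\<Prod>j<r. CARD('f) ^ r - CARD('f) ^ j)
    \<le> (CARD('f) ^ CARD('n)) ^ r * CARD('a) ^ r"
proof -
  let ?X = "{x :: 'a ^ 'n. rk h x \<le> r}"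
  let ?L = "{us :: ('f ^ 'n) list. length us = r}"
  let ?D = "\<lambda>us. vec.span (map_coords h ` set us)"
  have finL: "finite ?L" and cardL: "card ?L = (CARD('f) ^ CARD('n)) ^ r"
    using finite_lists_length_eq[of "UNIV :: ('f ^ 'n) set" r]
      card_lists_length_eq[of "UNIV :: ('f ^ 'n) set" r] by simp_all
  \<comment> \<open>Double counting of the pairs \<open>x\<close>, \<open>us\<close> with
    \<open>x \<in> ?D us\<close>: each \<open>x\<close> occurs with every ordered basis of its
    \<open>W\<close>, each \<open>us\<close> with at most \<open>CARD('a) ^ r\<close>
    vectors.\<close>
  have "card ?X * (\<Prod>j<r. CARD('f) ^ r - CARD('f) ^ j) \<le>
      (\<Sum>x\<in>?X. card {us\<in>?L. x \<in> ?D us})"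
  proof (subst of_nat_id[symmetric, of "card ?X"], rule sum_bounded_below)
    fix x assume "x \<in> ?X"
    then have "rk h x \<le> r" by simp
    then obtain W :: "('f ^ 'n) set" where W: "vec.subspace W" "vec.dim W = r"
      and x: "\<And>B. W \<subseteq> vec.span B \<Longrightarrow> x \<in> vec.span (map_coords h ` B)"
      using rk_span_witness_subspace[OF h _ r] by metis
    have "indep_lists W r \<subseteq> {us\<in>?L. x \<in> ?D us}"
    proof
      fix us assume us: "us \<in> indep_lists W r"
      then have "set us \<subseteq> W" "vec.independent (set us)" "card (set us) = r"
        by (auto simp: indep_lists_def distinct_card)
      then have "W \<subseteq> vec.span (set us)"
        using W(2) by (intro vec.card_ge_dim_independent) auto
      then show "us \<in> {us\<in>?L. x \<in> ?D us}"
        using us x by (simp add: indep_lists_def)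
    qed
    then have "card (indep_lists W r) \<le> card {us\<in>?L. x \<in> ?D us}"
      by (intro card_mono) (use finL in auto)
    then show "(\<Prod>j<r. CARD('f) ^ r - CARD('f) ^ j) \<le> card {us\<in>?L. x \<in> ?D us}"
      using card_indep_lists_ge[OF W(1), of r] W(2) by simp
  qed
  also have "\<dots> = (\<Sum>us\<in>?L. card {x\<in>?X. x \<in> ?D us})"
    by (rule sum_multicount_gen) (use finL in auto)
  also have "\<dots> \<le> of_nat (card ?L) * CARD('a) ^ r"
  proof (rule sum_bounded_above)
    fix us :: "('f ^ 'n) list" assume "us \<in> ?L"
    then have "card (map_coords h ` set us) \<le> r"
      using card_image_le[of "set us" "map_coords h"] card_length[of us] by simp
    then have "CARD('a) ^ card (map_coords h ` set us) \<le> CARD('a) ^ r"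
      by (intro power_increasing) (auto simp: Suc_leI)
    moreover have "card {x\<in>?X. x \<in> ?D us} \<le> card (?D us)"
      by (intro card_mono) auto
    ultimately show "card {x\<in>?X. x \<in> ?D us} \<le> CARD('a) ^ r"
      using card_span_le[of "map_coords h ` set us"] by linarith
  qed
  finally show ?thesis by (simp add: cardL)
qed

section \<open>Supports and information sets\<close>

text \<open>No independent family contains a zero coordinate.\<close>

lemma rk_le_card_support:
  assumes h: "field_embedding h"
  shows "rk h x \<le> card {i. x $ i \<noteq> 0}"
proof -
  interpret H: vector_space "\<lambda>c v. h c * v"
    using h by (rule field_embedding_vector_space)
  obtain I where I: "indep_coords h x I" "card I = rk h x"
    using h by (rule rk_obtain)
  have "x $ i \<noteq> 0" if "i \<in> I" for i
    using I(1) that H.dependent_zero[of "(\<lambda>i. x $ i) ` I"] unfolding indep_coords_def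
    by (metis imageI)
  then have "I \<subseteq> {i. x $ i \<noteq> 0}" by blast
  then show ?thesis
    using I(2) card_mono[of "{i. x $ i \<noteq> 0}" I] by simp
qed

text \<open>\<open>J\<close> is the complement of an information set: the codeword \<open>c\<close>
  can be chosen to agree with \<open>x\<close> everywhere outside \<open>J\<close>.\<close>

lemma subspace_add_coordinate_subspace:
  fixes C :: "('a::field ^ 'n) set"
  assumes C: "vec.subspace C"
  obtains J where "card J + vec.dim C = CARD('n)"
    and "\<And>x. \<exists>c\<in>C. {i. (x - c) $ i \<noteq> 0} \<subseteq> J"
proof -
  obtain B where B: "B \<subseteq> C" "vec.independent B" "C \<subseteq> vec.span B" "card B = vec.dim C"
    using vec.basis_exists by blast
  obtain B' where B': "B \<subseteq> B'" "B' \<subseteq> B \<union> cart_basis" "vec.independent B'"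
      "B \<union> cart_basis \<subseteq> vec.span B'"
    using vec.maximal_independent_subset_extend[of B "B \<union> cart_basis"] B(2) by auto
  have "vec.span cart_basis \<subseteq> vec.span B'"
    using B'(4) by (intro vec.span_minimal vec.subspace_span) auto
  then have span: "vec.span B' = UNIV"
    using span_cart_basis by auto
  have fin: "finite B'"
    using B'(3) vec.finiteI_independent by blast
  have cardB': "card B' = CARD('n)"
    using B'(3) span vec.dim_eq_card[of B' UNIV] card_cart_basis[where 'a = 'a and 'i = 'n]
    by (auto simp: vec.dim_UNIV)
  \<comment> \<open>All vectors of \<open>B' - B\<close> are unit vectors, because \<open>B'\<close>
    lies in \<open>B \<union> cart_basis\<close>; \<open>J\<close> collects their positions.\<close>
  define J where "J = {i. axis i 1 \<in> B' - B}"
  have img: "(\<lambda>i. axis i 1) ` J = B' - B"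
    using B'(2) by (auto simp: J_def cart_basis_def)
  have "card J = card (B' - B)"
    unfolding img[symmetric]
    by (rule card_image[symmetric]) (auto simp: inj_on_def axis_eq_axis)
  moreover have "card (B' - B) + card B = card B'"
    using fin B'(1) by (simp add: card_Diff_subset card_mono finite_subset)
  ultimately have "card J + vec.dim C = CARD('n)"
    using B(4) cardB' by simp
  moreover have "\<exists>c\<in>C. {i. (x - c) $ i \<noteq> 0} \<subseteq> J" for x
  proof -
    have "x \<in> vec.span (B \<union> (B' - B))"
      using span B'(1) by (simp add: Un_absorb1)
    then obtain c e where ce: "x = c + e" "c \<in> vec.span B" "e \<in> vec.span (B' - B)"
      unfolding vec.span_Un by blast
    \<comment> \<open>The vectors vanishing outside \<open>J\<close> form a subspace containing
      \<open>B' - B\<close>, hence also \<open>e\<close>.\<close>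
    have "vec.subspace {e :: 'a ^ 'n. \<forall>i. i \<notin> J \<longrightarrow> e $ i = 0}"
      by (auto simp: vec.subspace_def)
    moreover have "B' - B \<subseteq> {e. \<forall>i. i \<notin> J \<longrightarrow> e $ i = 0}"
      unfolding img[symmetric] by (auto simp: axis_def)
    ultimately have "{i. e $ i \<noteq> 0} \<subseteq> J"
      using ce(3) vec.span_minimal by blast
    moreover have "c \<in> C"
      using ce(2) B(1) C vec.span_minimal by blast
    ultimately show ?thesis using ce(1) by (intro bexI[of _ c]) simp_all
  qed
  ultimately show thesis by (rule that)
qed

section \<open>Covering radius against dimension, and sphere covering\<close>

lemma rank_dist_le_covering_radius:
  fixes h :: "'f::field \<Rightarrow> 'a::{field,finite}"
  assumes "C \<noteq> {}"
  obtains c where "c \<in> C" "rank_dist h x c \<le> rank_covering_radius h C"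
proof -
  have "Min (rank_dist h x ` C) \<in> rank_dist h x ` C"
    using assms by (intro Min_in) auto
  moreover have "Min (rank_dist h x ` C) \<le> rank_covering_radius h C"
    unfolding rank_covering_radius_def by (intro Max_ge) auto
  ultimately show thesis using that by auto
qed

text \<open>Besides the upper bound on the dimension, this shows that the covering radius is at most
  the length, as the estimate of the ball size requires.\<close>

lemma covering_radius_add_dim_le:
  fixes C :: "('a::{field,finite} ^ 'n) set"
  assumes h: "field_embedding h" and C: "vec.subspace C"
  shows "rank_covering_radius h C + vec.dim C \<le> CARD('n)"
proof -
  obtain J where J: "card J + vec.dim C = CARD('n)"
    and supp: "\<And>x. \<exists>c\<in>C. {i. (x - c) $ i \<noteq> 0} \<subseteq> J"
    using subspace_add_coordinate_subspace[OF C] by metis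
  have "Min (rank_dist h x ` C) \<le> card J" for x
  proof -
    obtain c where c: "c \<in> C" "{i. (x - c) $ i \<noteq> 0} \<subseteq> J"
      using supp by blast
    have "Min (rank_dist h x ` C) \<le> rank_dist h x c"
      using c(1) by (intro Min_le) auto
    also have "\<dots> \<le> card {i. (x - c) $ i \<noteq> 0}"
      unfolding rank_dist_def by (rule rk_le_card_support[OF h])
    also have "\<dots> \<le> card J"
      using c(2) by (intro card_mono) auto
    finally show ?thesis .
  qed
  then have "rank_covering_radius h C \<le> card J"
    unfolding rank_covering_radius_def by (subst Max_le_iff) auto
  then show ?thesis using J by linarith
qed

text \<open>The balls around the codewords are translates of the ball around 0:
  \<open>x = c + (x - c)\<close> with \<open>c\<close> a nearest codeword.\<close>

lemma sphere_covering:
  fixes C :: "('a::{field,finite} ^ 'n) set"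
  assumes "C \<noteq> {}"
  shows "CARD('a) ^ CARD('n) \<le>
    card C * card {x :: 'a ^ 'n. rk h x \<le> rank_covering_radius h C}"
proof -
  let ?X = "{x :: 'a ^ 'n. rk h x \<le> rank_covering_radius h C}"
  have "x \<in> (\<lambda>(c, e). c + e) ` (C \<times> ?X)" for x
  proof -
    obtain c where "c \<in> C" "rank_dist h x c \<le> rank_covering_radius h C"
      using assms by (rule rank_dist_le_covering_radius)
    then show ?thesis
      by (intro image_eqI[of _ _ "(c, x - c)"]) (auto simp: rank_dist_def)
  qed
  then have "card (UNIV :: ('a ^ 'n) set) \<le> card (C \<times> ?X)"
    by (intro surj_card_le) auto
  then show ?thesis by (simp add: card_cartesian_product)
qed

section \<open>The infinite product and the order of the general linear group\<close>

text \<open>The factors lie strictly between 0 and 1, so the partial products decrease to the limit;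
  their distances to 1 form a geometric series, so the limit is not 0.\<close>

lemma K_const_bounds:
  assumes "q \<ge> 2"
  shows "0 < K_const q" and "K_const q < (\<Prod>i<r. 1 - 1 / real q ^ Suc i)"
proof -
  define f where "f i = 1 - 1 / real q ^ Suc i" for i
  have "1 < real q ^ Suc i" for i
    using assms by (intro one_less_power) auto
  then have f: "0 < f i" "f i < 1" for i
    using assms by (simp_all add: f_def del: power_Suc)
  have "summable (\<lambda>i. (1 / real q) * (1 / real q) ^ i)"
    using assms by (intro summable_mult summable_geometric) auto
  then have "summable (\<lambda>i. norm (f i - 1))"
    by (simp add: f_def power_one_over)
  then have conv: "convergent_prod f"
    by (intro abs_convergent_prod_imp_convergent_prod) 
       (simp add: abs_convergent_prod_conv_summable)
  have lim: "(\<lambda>n. \<Prod>i\<le>n. f i) \<longlonglongrightarrow> K_const q"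
    using convergent_prod_LIMSEQ[OF conv] by (simp only: f_def[abs_def] K_const_def)
  have "K_const q \<noteq> 0"
    using prodinf_nonzero[OF conv] f(1) unfolding K_const_def f_def[abs_def] by (metis less_irrefl)
  moreover have "0 \<le> K_const q"
    using f(1) by (intro LIMSEQ_le_const[OF lim] exI[of _ 0]) (simp add: prod_nonneg less_imp_le)
  ultimately show "0 < K_const q" by simp
  have "decseq (\<lambda>n. \<Prod>i\<le>n. f i)"
    using f by (intro decseq_SucI) (simp add: mult_left_le less_imp_le prod_nonneg)
  \<comment> \<open>The partial product up to index \<open>r\<close> has \<open>r + 1\<close>
    factors; the extra factor \<open>f r < 1\<close> makes the inequality strict.\<close>
  from decseq_ge[OF this lim, of r] have "K_const q \<le> (\<Prod>i<r. f i) * f r"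
    by (simp add: lessThan_Suc_atMost[symmetric])
  also have "\<dots> < (\<Prod>i<r. f i) * 1"
    using f by (intro mult_strict_left_mono prod_pos) auto
  finally show "K_const q < (\<Prod>i<r. 1 - 1 / real q ^ Suc i)"
    by (simp add: f_def)
qed

text \<open>Each of the \<open>r\<close> factors on the left contributes \<open>q ^ r\<close>;
  reversing the index turns the exponents \<open>r - j\<close> into \<open>Suc i\<close>.\<close>

lemma prod_power_diff:
  assumes "q \<ge> 2"
  shows "real (\<Prod>j<r. q ^ r - q ^ j) = real q ^ (r * r) * (\<Prod>i<r. 1 - 1 / real q ^ Suc i)"
proof -
  have "real (\<Prod>j<r. q ^ r - q ^ j) = (\<Prod>j<r. real q ^ r * (1 - 1 / real q ^ (r - j)))"
  proof (subst of_nat_prod, rule prod.cong)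
    fix j assume "j \<in> {..<r}"
    then have "q ^ j \<le> q ^ r" "real q ^ r = real q ^ (r - j) * real q ^ j"
      using assms by (auto simp: power_add[symmetric] intro: power_increasing)
    then show "real (q ^ r - q ^ j) = real q ^ r * (1 - 1 / real q ^ (r - j))"
      using assms by (simp add: of_nat_diff right_diff_distrib)
  qed simp
  also have "\<dots> = real q ^ (r * r) * (\<Prod>j<r. 1 - 1 / real q ^ (r - j))"
    by (simp add: prod.distrib power_mult)
  also have "(\<Prod>j<r. 1 - 1 / real q ^ (r - j)) = (\<Prod>i<r. 1 - 1 / real q ^ Suc i)"
    by (subst prod.nat_diff_reindex[symmetric]) (auto intro!: prod.cong)
  finally show ?thesis .
qed

theorem proposition13:
  fixes q m n k \<rho> :: nat
    and h :: "'f::{field,finite} \<Rightarrow> 'a::{field,finite}"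
    and C :: "('a ^ 'n) set"
  assumes "primepow q" and "m > 0" and "n > 0"
    and "CARD('f) = q" and "CARD('a) = q ^ m" and "CARD('n) = n"
    and "field_embedding h"
    and "linear_code k C"
    and "rank_covering_radius h C = \<rho>"
  shows "real n - real \<rho>
           - (real \<rho> * (real n - real \<rho>) - log (real q) (K_const q)) / real m < real k
         \<and> real k \<le> real n - real \<rho>"
proof
  have q: "q \<ge> 2"
    using assms(1) primepow_gt_Suc_0 by fastforce
  have C: "vec.subspace C" "vec.dim C = k"
    using assms(8) by (auto simp: linear_code_def)
  have le: "\<rho> + k \<le> n"
    using covering_radius_add_dim_le[OF assms(7) C(1)] C(2) assms(6,9) by simp
  then show "real k \<le> real n - real \<rho>" by linarith
  let ?b = "card {x :: 'a ^ 'n. rk h x \<le> \<rho>}"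
  let ?g = "\<Prod>j<\<rho>. q ^ \<rho> - q ^ j"
  have "C \<noteq> {}"
    using C(1) vec.subspace_0 by blast
  then have "q ^ (m * n) \<le> q ^ (m * k) * ?b"
    using sphere_covering[of C h] card_subspace[OF C(1)] C(2) assms(5,6,9)
    by (simp add: power_mult)
  \<comment> \<open>The factor \<open>?g\<close> brings the ball size into the form of the double
    counting bound.\<close>
  then have "q ^ (m * n) * ?g \<le> q ^ (m * k) * (?b * ?g)"
    by (metis mult.assoc mult_le_mono1)
  also have "?b * ?g \<le> q ^ (n * \<rho> + m * \<rho>)"
    using card_rank_ball_le[OF assms(7), of \<rho>, where 'n = 'n] assms(4-6) le
    by (simp add: power_mult power_add)
  finally have "q ^ (m * n) * ?g \<le> q ^ (m * k + n * \<rho> + m * \<rho>)"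
    by (simp add: power_add mult.assoc)
  then have "real (q ^ (m * n)) * real ?g \<le> real (q ^ (m * k + n * \<rho> + m * \<rho>))"
    unfolding of_nat_mult[symmetric] of_nat_le_iff .
  then have "real q ^ (m * n + \<rho> * \<rho>) * (\<Prod>i<\<rho>. 1 - 1 / real q ^ Suc i)
      \<le> real q ^ (m * k + n * \<rho> + m * \<rho>)"
    unfolding prod_power_diff[OF q] by (simp add: power_add mult.assoc)
  \<comment> \<open>Replacing the finite product by the infinite one makes the bound independent of
    \<rho> and strict.\<close>
  moreover have "real q ^ (m * n + \<rho> * \<rho>) * K_const q
      < real q ^ (m * n + \<rho> * \<rho>) * (\<Prod>i<\<rho>. 1 - 1 / real q ^ Suc i)"
    using q K_const_bounds(2)[OF q] by (intro mult_strict_left_mono) auto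
  ultimately have "real q ^ (m * n + \<rho> * \<rho>) * K_const q < real q ^ (m * k + n * \<rho> + m * \<rho>)"
    by (rule order.strict_trans2[rotated])
  then have "log q (real q ^ (m * n + \<rho> * \<rho>) * K_const q)
      < log q (real q ^ (m * k + n * \<rho> + m * \<rho>))"
    using q K_const_bounds(1)[OF q] by (intro log_less) auto
  then have "real (m * n + \<rho> * \<rho>) + log q (K_const q) < real (m * k + n * \<rho> + m * \<rho>)"
    using q K_const_bounds(1)[OF q] by (simp add: log_mult log_nat_power)
  \<comment> \<open>Since \<open>m * n + \<rho> * \<rho> - n * \<rho> - m * \<rho>\<close> equals
    \<open>m * (n - \<rho>) - \<rho> * (n - \<rho>)\<close>, division by \<open>m\<close> gives the
    claim.\<close>
  then show "real n - real \<rho>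
      - (real \<rho> * (real n - real \<rho>) - log (real q) (K_const q)) / real m < real k"
    using assms(2) by (simp add: field_simps)
qed

end
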